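(* For every integer $q \geq 2$, \[ \mathbb{I}(Z_2,q) = \sum_{j=0}^{\infty} \frac{(-1)^j q^{\left(1-2^{j+1}\right)}}{\prod_{k=0}^{j} \left(1 - q^{\left(1-2^{k+1}\right)}\right)}. \]
   Context: $Z_2 = aba$. A word $U$ is an instance of $aba$ if $U = XYX$ for some nonempty words $X,Y$. For $q\ge 1$, $[q]=\{1,\dots,q\}$; $\mathbb{I}_n(Z_2,q)$ is the probability that a uniformly random word in $[q]^n$ is an instance of $Z_2$, and $\mathbb{I}(Z_2,q)=\lim_{n\to\infty}\mathbb{I}_n(Z_2,q)$ (this limit exists). *)

theory Defs
  imports "HOL-Probability.Probability"
begin

definition instance_Z2 :: "'a list \<Rightarrow> bool" where
  "instance_Z2 U \<longleftrightarrow> (\<exists>X Y. X \<noteq> [] \<and> Y \<noteq> [] \<and> U = X @ Y @ X)"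

definition words :: "nat \<Rightarrow> nat \<Rightarrow> nat list set" where
  "words q n = {w. set w \<subseteq> {1..q} \<and> length w = n}"

definition prob_Z2 :: "nat \<Rightarrow> nat \<Rightarrow> real" where
  "prob_Z2 n q = measure_pmf.prob (pmf_of_set (words q n)) {U. instance_Z2 U}"

definition lim_prob_Z2 :: "nat \<Rightarrow> real" where
  "lim_prob_Z2 q = lim (\<lambda>n. prob_Z2 n q)"

end

theory Submission imports Defs begin

text \<open>
  A word \<open>XYX\<close> of length \<open>n\<close> has a shortest border, which is unbordered and has length
  at most \<open>n / 2\<close>; conversely every unbordered \<open>X\<close> is the shortest border of \<open>XYX\<close>.
  If \<open>b k\<close> counts the unbordered words of length \<open>k\<close>, then the probability is the sum of
  \<open>b k / q ^ (2 * k)\<close> over \<open>0 < 2 * k < n\<close>, and its limit is the generating function \<open>B\<close> of \<open>b\<close> at \<open>q\<^sup>-\<^sup>2\<close>. Counting the bordered words in the same way yields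
  \<open>(1 - q x) B(x) = q x - B(x\<^sup>2)\<close>, and iterating this equation at \<open>x = q\<^sup>-\<^sup>2\<close> gives the series.
\<close>

section \<open>Borders\<close>

definition border :: "nat \<Rightarrow> 'a list \<Rightarrow> bool" where
  "border k w \<longleftrightarrow> 0 < k \<and> k < length w \<and> take k w = drop (length w - k) w"

definition shortest_border :: "nat \<Rightarrow> 'a list \<Rightarrow> bool" where
  "shortest_border k w \<longleftrightarrow> border k w \<and> (\<forall>j<k. \<not> border j w)"

definition unbordered :: "'a list \<Rightarrow> bool" where
  "unbordered w \<longleftrightarrow> (\<forall>k. \<not> border k w)"

text \<open>The prefix and the suffix of length \<open>k\<close> intersect in a factor of length
  \<open>2 * k - length w\<close>. It ends the prefix and begins the suffix; as these are the same
  word, it both begins and ends \<open>w\<close>.\<close>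

lemma border_overlap:
  assumes "border k w" "length w < 2 * k"
  shows "border (2 * k - length w) w"
proof -
  define n where "n = length w"
  have k: "k < n" "n < 2 * k" "take k w = drop (n - k) w"
    using assms by (auto simp: border_def n_def)
  have "2 * k - n \<le> k" using k(1) by linarith
  then have "take (2 * k - n) w = take (2 * k - n) (take k w)"
    by (simp add: min_absorb1)
  also have "\<dots> = take (k - (n - k)) (drop (n - k) w)"
    using k(1) by (simp add: k(3) mult_2)
  \<comment> \<open>Both sides are the factor shared by the two occurrences of the border.\<close>
  also have "\<dots> = drop (n - k) (take k w)"
    by (simp add: drop_take)
  also have "\<dots> = drop (n - (2 * k - n)) w"
  proof -
    have "n - k + (n - k) = n - (2 * k - n)" using k(1,2) by linarith
    then show ?thesis by (simp add: k(3))
  qed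
  finally show ?thesis
    using k(1,2) by (auto simp: border_def n_def)
qed

text \<open>A suffix of \<open>w\<close> shorter than \<open>k\<close> lies within the final copy of
  the border, so it is also a suffix of \<open>take k w\<close>.\<close>

lemma border_take_iff:
  assumes "border k w" "j < k"
  shows "border j (take k w) \<longleftrightarrow> border j w"
proof -
  have k: "k < length w" "take k w = drop (length w - k) w"
    using assms by (auto simp: border_def)
  have "drop (k - j) (take k w) = drop (length w - j) w"
    using k assms(2) by simp
  then show ?thesis
    using k(1) assms(2) by (auto simp: border_def min_def)
qed

lemma shortest_border_exists: "border k w \<Longrightarrow> \<exists>j\<le>k. shortest_border j w"
  unfolding shortest_border_def
  by (intro exI[of _ "LEAST j. border j w"]) (auto intro: LeastI Least_le dest: not_less_Least)

lemma shortest_border_unique: "shortest_border j w \<Longrightarrow> shortest_border k w \<Longrightarrow> j = k"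
  unfolding shortest_border_def by (metis linorder_neqE_nat)

text \<open>A border longer than half the word overlaps itself, and the overlap is a strictly
  shorter border because \<open>k < length w\<close>.\<close>

lemma shortest_border_le_half:
  assumes "shortest_border k w"
  shows "2 * k \<le> length w"
proof (rule ccontr)
  assume "\<not> 2 * k \<le> length w"
  then have "length w < 2 * k" by simp
  moreover have "border k w" "k < length w"
    using assms by (auto simp: shortest_border_def border_def)
  ultimately have "border (2 * k - length w) w" "2 * k - length w < k"
    using border_overlap by auto
  then show False
    using assms by (auto simp: shortest_border_def)
qed

text \<open>Below \<open>k\<close> the borders of \<open>w\<close> and of its prefix coincide, so
  minimality is a condition on the prefix alone. This leaves the middle of the word free in the
  count.\<close>

lemma shortest_border_iff:
  assumes "border k w"
  shows "shortest_border k w \<longleftrightarrow> unbordered (take k w)"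
proof -
  have "\<not> border j (take k w)" if "k \<le> j" for j
    using that by (auto simp: border_def)
  then have "unbordered (take k w) \<longleftrightarrow> (\<forall>j<k. \<not> border j (take k w))"
    unfolding unbordered_def using linorder_not_less by blast
  then show ?thesis
    using assms border_take_iff[OF assms] by (auto simp: shortest_border_def)
qed

lemma border_append3: "X \<noteq> [] \<Longrightarrow> border (length X) (X @ Y @ X)"
  by (simp add: border_def)

lemma border_factorization:
  assumes "border k w" "2 * k \<le> length w"
  shows "w = take k w @ take (length w - 2 * k) (drop k w) @ take k w"
proof -
  have "w = take k w @ take (length w - 2 * k) (drop k w) @ drop (length w - 2 * k) (drop k w)"
    by (simp only: append_take_drop_id)
  also have "drop (length w - 2 * k) (drop k w) = drop (length w - k) w"
    using assms(2) by simp
  also have "\<dots> = take k w"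
    using assms(1) by (simp add: border_def)
  finally show ?thesis .
qed

text \<open>Passing from \<open>X\<close> to the shortest border can only lengthen the middle
  factor, so it stays nonempty. The strict inequality encodes that \<open>Y\<close> is
  nonempty.\<close>

lemma instance_Z2_iff_shortest_border:
  "instance_Z2 w \<longleftrightarrow> (\<exists>k. 2 * k < length w \<and> shortest_border k w)"
proof
  assume "instance_Z2 w"
  then obtain X Y where XY: "X \<noteq> []" "Y \<noteq> []" "w = X @ Y @ X"
    unfolding instance_Z2_def by blast
  then obtain j where "j \<le> length X" "shortest_border j w"
    using border_append3 shortest_border_exists by metis
  moreover have "2 * length X < length w"
    using XY by simp
  ultimately show "\<exists>k. 2 * k < length w \<and> shortest_border k w"
    by (intro exI[of _ j]) auto
next
  assume "\<exists>k. 2 * k < length w \<and> shortest_border k w"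
  then obtain k where k: "2 * k < length w" "border k w"
    by (auto simp: shortest_border_def)
  have "0 < k" using k(2) by (simp add: border_def)
  then have "take k w \<noteq> []" "take (length w - 2 * k) (drop k w) \<noteq> []"
    using k(1) by auto
  moreover have "w = take k w @ take (length w - 2 * k) (drop k w) @ take k w"
    using k by (intro border_factorization) auto
  ultimately show "instance_Z2 w"
    unfolding instance_Z2_def by blast
qed

text \<open>The equality case of the bound covers squares \<open>X @ X\<close>, which are bordered
  although their halves leave no room for a middle factor.\<close>

lemma unbordered_iff_no_shortest_border:
  "unbordered w \<longleftrightarrow> \<not> (\<exists>k. 2 * k \<le> length w \<and> shortest_border k w)"
proof -
  have "\<not> unbordered w \<longleftrightarrow> (\<exists>k. shortest_border k w)"
    unfolding unbordered_def using shortest_border_exists shortest_border_def by blast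
  then show ?thesis using shortest_border_le_half by blast
qed

section \<open>Counting\<close>

lemma finite_words: "finite (words q n)"
  unfolding words_def by (rule finite_lists_length_eq) simp

lemma card_words: "card (words q n) = q ^ n"
  unfolding words_def using card_lists_length_eq[of "{1..q}" n] by simp

definition unbordered_words :: "nat \<Rightarrow> nat \<Rightarrow> nat list set" where
  "unbordered_words q n = {w \<in> words q n. unbordered w}"

lemma card_unbordered_words_le: "card (unbordered_words q n) \<le> q ^ n"
  unfolding card_words[symmetric]
  by (rule card_mono) (auto simp: finite_words unbordered_words_def)

lemma shortest_border_words_eq:
  assumes "0 < k" "2 * k \<le> n"
  shows "{w \<in> words q n. shortest_border k w} =
    (\<lambda>(X, Y). X @ Y @ X) ` (unbordered_words q k \<times> words q (n - 2 * k))"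
    (is "?L = ?R")
proof (intro equalityI subsetI)
  fix w assume "w \<in> ?L"
  then have w: "w \<in> words q n" "shortest_border k w" "border k w"
    by (auto simp: shortest_border_def)
  have len: "length w = n" using w(1) by (simp add: words_def)
  have "take k w \<in> unbordered_words q k"
    using w shortest_border_iff[OF w(3)] assms
    by (auto simp: unbordered_words_def words_def dest: in_set_takeD)
  moreover have "take (n - 2 * k) (drop k w) \<in> words q (n - 2 * k)"
    using w(1) assms by (auto simp: words_def dest!: in_set_takeD in_set_dropD)
  moreover have "w = take k w @ take (n - 2 * k) (drop k w) @ take k w"
    using border_factorization[OF w(3)] assms len by simp
  ultimately show "w \<in> ?R"
    by (intro image_eqI[of _ _ "(take k w, take (n - 2 * k) (drop k w))"]) auto
next
  fix w assume "w \<in> ?R"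
  then obtain X Y where XY: "X \<in> unbordered_words q k" "Y \<in> words q (n - 2 * k)"
    and w: "w = X @ Y @ X" by auto
  have len: "length X = k" "length Y = n - 2 * k" and X: "unbordered X"
    using XY by (auto simp: unbordered_words_def words_def)
  have "border k w"
    using border_append3[of X Y] len assms by (auto simp: w)
  then have "shortest_border k w"
    using shortest_border_iff[of k w] X len by (simp add: w)
  moreover have "w \<in> words q n"
    using XY len assms by (auto simp: w unbordered_words_def words_def)
  ultimately show "w \<in> ?L" by simp
qed

lemma card_shortest_border_words:
  assumes "0 < k" "2 * k \<le> n"
  shows "card {w \<in> words q n. shortest_border k w} =
    card (unbordered_words q k) * q ^ (n - 2 * k)"
proof -
  \<comment> \<open>The lengths of \<open>X\<close> and \<open>Y\<close> are fixed, so both factors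
    can be read off from the word.\<close>
  have "inj_on (\<lambda>(X, Y). X @ Y @ X) (unbordered_words q k \<times> words q (n - 2 * k))"
    by (auto simp: inj_on_def unbordered_words_def words_def)
  then show ?thesis
    by (simp add: shortest_border_words_eq[OF assms] card_image card_cartesian_product card_words)
qed

text \<open>Uniqueness of the shortest border makes the classes disjoint. The index set is general
  in order to serve both \<open>2 * k < n\<close> (instances of \<open>aba\<close>) and
  \<open>2 * k \<le> n\<close> (bordered words).\<close>

lemma card_shortest_border_in:
  assumes "K \<subseteq> {k. 0 < k \<and> 2 * k \<le> n}"
  shows "card {w \<in> words q n. \<exists>k\<in>K. shortest_border k w} =
    (\<Sum>k\<in>K. card (unbordered_words q k) * q ^ (n - 2 * k))"
proof -
  have "K \<subseteq> {..n}" using assms by auto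
  then have fin: "finite K" by (rule finite_subset) simp
  have "{w \<in> words q n. \<exists>k\<in>K. shortest_border k w} =
      (\<Union>k\<in>K. {w \<in> words q n. shortest_border k w})" by auto
  also have "card \<dots> = (\<Sum>k\<in>K. card {w \<in> words q n. shortest_border k w})"
    using fin shortest_border_unique
    by (intro card_UN_disjoint) (auto simp: finite_words)
  also have "\<dots> = (\<Sum>k\<in>K. card (unbordered_words q k) * q ^ (n - 2 * k))"
    using assms by (intro sum.cong refl card_shortest_border_words) auto
  finally show ?thesis .
qed

lemma shortest_border_pos: "shortest_border k w \<Longrightarrow> 0 < k"
  by (simp add: shortest_border_def border_def)

text \<open>The empty word is unbordered, but it must not contribute to the generating function.\<close>

definition unbordered_count :: "nat \<Rightarrow> nat \<Rightarrow> real" where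
  "unbordered_count q n = (if n = 0 then 0 else real (card (unbordered_words q n)))"

lemma unbordered_count_0 [simp]: "unbordered_count q 0 = 0"
  by (simp add: unbordered_count_def)

lemma unbordered_count_nonneg: "0 \<le> unbordered_count q n"
  by (simp add: unbordered_count_def)

lemma unbordered_count_le: "unbordered_count q n \<le> real q ^ n"
  using card_unbordered_words_le[of q n]
  by (simp add: unbordered_count_def flip: of_nat_power)

lemma unbordered_count_eq:
  assumes "0 < n"
  shows "unbordered_count q n =
    real q ^ n - (\<Sum>k | 0 < k \<and> 2 * k \<le> n. unbordered_count q k * real q ^ (n - 2 * k))"
proof -
  let ?K = "{k. 0 < k \<and> 2 * k \<le> n}"
  let ?B = "{w \<in> words q n. \<exists>k\<in>?K. shortest_border k w}"
  have "unbordered w \<longleftrightarrow> \<not> (\<exists>k\<in>?K. shortest_border k w)" if "w \<in> words q n" for w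
    using that shortest_border_pos[of _ w]
    by (auto simp: unbordered_iff_no_shortest_border words_def)
  then have "words q n = unbordered_words q n \<union> ?B" "unbordered_words q n \<inter> ?B = {}"
    by (auto simp: unbordered_words_def)
  then have "card (words q n) = card (unbordered_words q n) + card ?B"
    by (metis (no_types, lifting) card_Un_disjoint finite_Un finite_words)
  then have "real (q ^ n) = real (card (unbordered_words q n)) + real (card ?B)"
    by (simp only: card_words of_nat_add)
  moreover have "real (card ?B) = (\<Sum>k\<in>?K. unbordered_count q k * real q ^ (n - 2 * k))"
    by (subst card_shortest_border_in) (auto simp: unbordered_count_def intro!: sum.cong)
  ultimately show ?thesis
    using assms by (simp add: unbordered_count_def)
qed

text \<open>Multiplying \<open>unbordered_count_eq\<close> for \<open>n\<close> by \<open>q\<close>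
  gives its version for \<open>Suc n\<close>, up to a new summand when \<open>Suc n\<close> is even.
  The extra \<open>q\<close> at \<open>n = 0\<close> compensates for the value 0 assigned to the
  empty word.\<close>

lemma unbordered_count_Suc:
  "unbordered_count q (Suc n) = real q * unbordered_count q n + (if n = 0 then real q else 0)
    - (if even (Suc n) then unbordered_count q (Suc n div 2) else 0)"
proof (cases "n = 0")
  case True
  have empty: "{k::nat. 0 < k \<and> 2 * k \<le> Suc 0} = {}" by auto
  have "unbordered_count q (Suc 0) = real q"
    using unbordered_count_eq[of "Suc 0" q] unfolding empty by simp
  then show ?thesis using True by simp
next
  case False
  let ?K = "\<lambda>n. {k. 0 < k \<and> 2 * k \<le> n}"
  let ?f = "\<lambda>n k. unbordered_count q k * real q ^ (n - 2 * k)"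
  have K: "?K (Suc n) = ?K n \<union> (if even (Suc n) then {Suc n div 2} else {})"
    by (auto elim!: oddE evenE)
  have fin: "finite (?K n)" by (rule finite_subset[of _ "{..n}"]) auto
  \<comment> \<open>At the new index \<open>Suc n div 2\<close> the exponent of \<open>q\<close> is
    0, so the bare count remains.\<close>
  have "sum (?f (Suc n)) (?K (Suc n)) =
      sum (?f (Suc n)) (?K n) + (if even (Suc n) then unbordered_count q (Suc n div 2) else 0)"
    unfolding K using fin by (subst sum.union_disjoint) auto
  moreover have "sum (?f (Suc n)) (?K n) = real q * sum (?f n) (?K n)"
    unfolding sum_distrib_left by (intro sum.cong) (auto simp: Suc_diff_le)
  moreover have "real q * unbordered_count q n = real q ^ Suc n - real q * sum (?f n) (?K n)"
    using False unbordered_count_eq[of n q] by (simp add: right_diff_distrib)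
  ultimately show ?thesis
    using False unbordered_count_eq[of "Suc n" q] by (simp only: zero_less_Suc if_False)
qed

text \<open>Shortest border length \<open>k\<close> accounts for a fraction of the words that does
  not depend on \<open>n\<close>; the word length enters only through the range of
  summation.\<close>

lemma prob_Z2_eq:
  assumes "0 < q"
  shows "prob_Z2 n q = (\<Sum>k | 0 < k \<and> 2 * k < n. unbordered_count q k * (1 / real q ^ 2) ^ k)"
proof -
  let ?K = "{k. 0 < k \<and> 2 * k < n}"
  \<comment> \<open>\<open>pmf_of_set\<close> is the uniform distribution only on nonempty finite
    sets.\<close>
  have "words q n \<noteq> {}"
    using card_words[of q n] assms by auto
  then have "prob_Z2 n q = real (card (words q n \<inter> {U. instance_Z2 U})) / real q ^ n"
    unfolding prob_Z2_def by (simp add: measure_pmf_of_set finite_words card_words)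
  also have "words q n \<inter> {U. instance_Z2 U} = {w \<in> words q n. \<exists>k\<in>?K. shortest_border k w}"
    using shortest_border_pos by (auto simp: instance_Z2_iff_shortest_border words_def)
  also have "real (card \<dots>) = (\<Sum>k\<in>?K. unbordered_count q k * real q ^ (n - 2 * k))"
    by (subst card_shortest_border_in) (auto simp: unbordered_count_def intro!: sum.cong)
  also have "\<dots> / real q ^ n = (\<Sum>k\<in>?K. unbordered_count q k * (1 / real q ^ 2) ^ k)"
    unfolding sum_divide_distrib
    using assms by (intro sum.cong) (auto simp: power_diff power_one_over simp flip: power_mult)
  finally show ?thesis .
qed

section \<open>The generating function\<close>

definition unbordered_gf :: "nat \<Rightarrow> real \<Rightarrow> real" where
  "unbordered_gf q x = (\<Sum>n. unbordered_count q n * x ^ n)"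

lemma unbordered_count_term_le:
  assumes "0 \<le> x"
  shows "unbordered_count q n * x ^ n \<le> (real q * x) ^ n"
  using assms unbordered_count_le[of q n] by (simp add: power_mult_distrib mult_right_mono)

lemma summable_unbordered_gf:
  assumes "0 \<le> x" "real q * x < 1"
  shows "summable (\<lambda>n. unbordered_count q n * x ^ n)"
proof (rule summable_comparison_test'[where N = 0])
  show "summable (\<lambda>n. (real q * x) ^ n)"
    using assms by (intro summable_geometric) (simp add: abs_mult)
  show "norm (unbordered_count q n * x ^ n) \<le> (real q * x) ^ n" for n
    using unbordered_count_term_le[OF assms(1), of q n] unbordered_count_nonneg[of q n] assms(1)
    by (simp add: abs_mult)
qed

lemma unbordered_gf_nonneg:
  assumes "0 \<le> x" "real q * x < 1"
  shows "0 \<le> unbordered_gf q x"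
  unfolding unbordered_gf_def
  using assms by (intro suminf_nonneg summable_unbordered_gf) (auto simp: unbordered_count_nonneg)

text \<open>This is the recurrence \<open>unbordered_count_Suc\<close> times
  \<open>x ^ Suc n\<close>, summed over \<open>n\<close>: the halved indices produce the value at
  \<open>x ^ 2\<close>. From \<open>x < 1\<close> follows \<open>x ^ 2 \<le> x\<close>, so that
  series converges as well.\<close>

lemma unbordered_gf_functional_equation:
  assumes "0 \<le> x" "x < 1" "real q * x < 1"
  shows "(1 - real q * x) * unbordered_gf q x = real q * x - unbordered_gf q (x ^ 2)"
proof -
  let ?b = "unbordered_count q"
  have "x ^ 2 \<le> x" using assms by (simp add: power2_eq_square mult_left_le)
  then have "real q * x ^ 2 \<le> real q * x" by (simp add: mult_left_mono)
  then have x2: "real q * x ^ 2 < 1" using assms by linarith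
  have sB: "(\<lambda>n. ?b n * x ^ n) sums unbordered_gf q x"
    unfolding unbordered_gf_def using summable_unbordered_gf assms by (intro summable_sums) auto
  have "(\<lambda>n. ?b n * (x ^ 2) ^ n) sums unbordered_gf q (x ^ 2)"
    unfolding unbordered_gf_def using summable_unbordered_gf x2 by (intro summable_sums) auto
  \<comment> \<open>The series in \<open>x ^ 2\<close> is spread over the even indices, with zeros
    at the odd ones.\<close>
  then have "(\<lambda>n. if even n then ?b (n div 2) * (x ^ 2) ^ (n div 2) else 0)
      sums unbordered_gf q (x ^ 2)"
    using sums_if[OF sums_zero] by simp
  \<comment> \<open>The shift discards only the term at index 0, which vanishes.\<close>
  then have sE: "(\<lambda>n. if even (Suc n) then ?b (Suc n div 2) * (x ^ 2) ^ (Suc n div 2) else 0)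
      sums unbordered_gf q (x ^ 2)"
    by (subst sums_Suc_iff) simp
  have "(\<lambda>n. real q * x * (?b n * x ^ n) + (if n = 0 then real q * x else 0) -
      (if even (Suc n) then ?b (Suc n div 2) * (x ^ 2) ^ (Suc n div 2) else 0))
      sums (real q * x * unbordered_gf q x + real q * x - unbordered_gf q (x ^ 2))"
    using sums_single[of 0 "\<lambda>_. real q * x"]
    by (intro sums_diff sums_add sums_mult sB sE) auto
  moreover have "real q * x * (?b n * x ^ n) + (if n = 0 then real q * x else 0) -
      (if even (Suc n) then ?b (Suc n div 2) * (x ^ 2) ^ (Suc n div 2) else 0) =
      ?b (Suc n) * x ^ Suc n" for n
  proof -
    have "(x ^ 2) ^ (Suc n div 2) = x ^ Suc n" if "even (Suc n)"
      using that by (simp only: power_mult[symmetric] dvd_mult_div_cancel)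
    then show ?thesis
      unfolding unbordered_count_Suc by (auto simp: algebra_simps)
  qed
  ultimately have "(\<lambda>n. ?b (Suc n) * x ^ Suc n)
      sums (real q * x * unbordered_gf q x + real q * x - unbordered_gf q (x ^ 2))"
    by simp
  moreover have "(\<lambda>n. ?b (Suc n) * x ^ Suc n) sums unbordered_gf q x"
    using sB by (subst sums_Suc_iff) simp
  ultimately have "unbordered_gf q x =
      real q * x * unbordered_gf q x + real q * x - unbordered_gf q (x ^ 2)"
    by (rule sums_unique2[symmetric])
  then show ?thesis by (simp add: algebra_simps)
qed

lemma prob_Z2_tendsto:
  assumes "2 \<le> q"
  shows "(\<lambda>n. prob_Z2 n q) \<longlonglongrightarrow> unbordered_gf q (1 / real q ^ 2)"
proof -
  let ?f = "\<lambda>k. unbordered_count q k * (1 / real q ^ 2) ^ k"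
  have "summable ?f"
    using assms by (intro summable_unbordered_gf) (auto simp: power2_eq_square)
  then have "(\<lambda>m. sum ?f {..<m}) \<longlonglongrightarrow> unbordered_gf q (1 / real q ^ 2)"
    unfolding unbordered_gf_def by (rule summable_LIMSEQ)
  \<comment> \<open>\<open>2 * k < n\<close> is equivalent to \<open>k < (n + 1) div 2\<close>, so
    the probabilities run through partial sums of the series.\<close>
  moreover have "filterlim (\<lambda>n::nat. (n + 1) div 2) at_top sequentially"
    unfolding filterlim_at_top eventually_sequentially
  proof
    fix m :: nat
    show "\<exists>N. \<forall>n\<ge>N. m \<le> (n + 1) div 2" by (rule exI[of _ "2 * m"]) auto
  qed
  ultimately have "(\<lambda>n. sum ?f {..<(n + 1) div 2}) \<longlonglongrightarrow> unbordered_gf q (1 / real q ^ 2)"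
    by (rule filterlim_compose)
  moreover have "prob_Z2 n q = sum ?f {..<(n + 1) div 2}" for n
  proof -
    have "prob_Z2 n q = sum ?f {k. 0 < k \<and> 2 * k < n}"
      using assms by (intro prob_Z2_eq) simp
    \<comment> \<open>The only possible additional summand, at \<open>k = 0\<close>,
      vanishes.\<close>
    also have "\<dots> = sum ?f {..<(n + 1) div 2}"
      by (rule sum.mono_neutral_left) auto
    finally show ?thesis .
  qed
  ultimately show ?thesis by simp
qed

section \<open>Iterating the functional equation\<close>

text \<open>The orbit under squaring of \<open>1 / real q ^ 2\<close>, the point at which the limit
  evaluates the generating function.\<close>

definition gf_point :: "nat \<Rightarrow> nat \<Rightarrow> real" where
  "gf_point q j = 1 / real q ^ (2 ^ (j + 1))"

lemma gf_point_Suc: "gf_point q (Suc j) = gf_point q j ^ 2"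
  by (simp add: gf_point_def power_divide mult.commute flip: power_mult)

lemma gf_point_nonneg: "0 \<le> gf_point q j"
  by (simp add: gf_point_def)

text \<open>The exponent \<open>2 ^ (j + 1)\<close> is at least \<open>2 * j + 2\<close>. Decay at
  rate 1/4 is what later outweighs the denominators, whose factors are only known to be at least
  1/2.\<close>

lemma mult_gf_point_le:
  assumes "2 \<le> q"
  shows "real q * gf_point q j \<le> 1 / 2 ^ (2 * j + 1)"
proof -
  have "j + 1 \<le> 2 ^ j" using less_exp[of j] by linarith
  then have "Suc (2 * j + 1) \<le> 2 ^ (j + 1)" by simp
  then have "real q ^ Suc (2 * j + 1) \<le> real q ^ (2 ^ (j + 1))"
    using assms by (intro power_increasing) auto
  moreover have "real q * 2 ^ (2 * j + 1) \<le> real q ^ Suc (2 * j + 1)"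
    using assms power_mono[of 2 "real q" "2 * j + 1"] by simp
  ultimately have "real q * 2 ^ (2 * j + 1) \<le> real q ^ (2 ^ (j + 1))"
    by linarith
  then show ?thesis
    using assms by (simp add: gf_point_def field_simps del: power_Suc)
qed

lemma mult_gf_point_le_half:
  assumes "2 \<le> q"
  shows "real q * gf_point q j \<le> 1 / 2"
proof -
  have "(1::real) / 2 ^ (2 * j + 1) \<le> 1 / 2 ^ 1"
    by (intro divide_left_mono power_increasing) auto
  then show ?thesis using mult_gf_point_le[OF assms, of j] unfolding power_one_right by linarith
qed

lemma gf_point_less_1:
  assumes "2 \<le> q"
  shows "gf_point q j < 1"
proof -
  have "2 * gf_point q j \<le> real q * gf_point q j"
    using assms gf_point_nonneg by (intro mult_right_mono) auto
  then show ?thesis using mult_gf_point_le_half[OF assms, of j] by linarith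
qed

lemma unbordered_gf_point_step:
  assumes "2 \<le> q"
  shows "(1 - real q * gf_point q j) * unbordered_gf q (gf_point q j) =
    real q * gf_point q j - unbordered_gf q (gf_point q (Suc j))"
  unfolding gf_point_Suc
  using gf_point_nonneg gf_point_less_1[OF assms] mult_gf_point_le_half[OF assms, of j]
  by (intro unbordered_gf_functional_equation) auto

lemma unbordered_gf_point_nonneg:
  assumes "2 \<le> q"
  shows "0 \<le> unbordered_gf q (gf_point q j)"
  using gf_point_nonneg mult_gf_point_le_half[OF assms, of j] by (intro unbordered_gf_nonneg) auto

text \<open>In the functional equation the subtracted value is nonnegative and the factor on the
  left is at least 1/2, so the value is at most twice \<open>real q * gf_point q j\<close>.\<close>

lemma unbordered_gf_point_le:
  assumes "2 \<le> q"
  shows "unbordered_gf q (gf_point q j) \<le> 1 / 2 ^ (2 * j)"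
proof -
  have "1 / 2 * unbordered_gf q (gf_point q j) \<le>
      (1 - real q * gf_point q j) * unbordered_gf q (gf_point q j)"
    using mult_gf_point_le_half[OF assms, of j] unbordered_gf_point_nonneg[OF assms]
    by (intro mult_right_mono) auto
  also have "\<dots> \<le> real q * gf_point q j"
    using unbordered_gf_point_step[OF assms] unbordered_gf_point_nonneg[OF assms] by simp
  also have "\<dots> \<le> 1 / 2 ^ (2 * j + 1)"
    by (rule mult_gf_point_le[OF assms])
  finally show ?thesis by simp
qed

text \<open>Each step solves the functional equation for the value in the remainder: this splits off
  one summand, flips the sign of the remainder and adds a factor to its denominator.\<close>

lemma unbordered_gf_iterate:
  assumes "2 \<le> q"
  shows "unbordered_gf q (gf_point q 0) =
    (\<Sum>j<m. (-1) ^ j * (real q * gf_point q j) / (\<Prod>k=0..j. 1 - real q * gf_point q k)) +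
    (-1) ^ m * unbordered_gf q (gf_point q m) / (\<Prod>k<m. 1 - real q * gf_point q k)"
proof (induction m)
  case 0
  show ?case by simp
next
  case (Suc m)
  let ?P = "\<Prod>k<m. 1 - real q * gf_point q k"
  let ?d = "1 - real q * gf_point q m"
  have "?d \<noteq> 0" using mult_gf_point_le_half[OF assms, of m] by linarith
  then have "unbordered_gf q (gf_point q m) =
      (real q * gf_point q m - unbordered_gf q (gf_point q (Suc m))) / ?d"
    using unbordered_gf_point_step[OF assms, of m] by (simp add: nonzero_eq_divide_eq mult.commute)
  then have "(-1) ^ m * unbordered_gf q (gf_point q m) / ?P =
      (-1) ^ m * (real q * gf_point q m) / (?P * ?d) +
      (-1) ^ Suc m * unbordered_gf q (gf_point q (Suc m)) / (?P * ?d)"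
    by (simp add: diff_divide_distrib right_diff_distrib mult.commute)
  moreover have "(\<Prod>k=0..m. 1 - real q * gf_point q k) = ?P * ?d"
    by (simp add: atLeast0AtMost flip: lessThan_Suc_atMost)
  ultimately show ?case
    using Suc.IH by simp
qed

text \<open>The numerator is at most \<open>1 / 2 ^ (2 * m)\<close> in absolute value and the
  product is at least \<open>(1 / 2) ^ m\<close>, so the quotient is bounded by
  \<open>(1 / 2) ^ m\<close>.\<close>

lemma unbordered_gf_remainder_tendsto_0:
  assumes "2 \<le> q"
  shows "(\<lambda>m. (-1) ^ m * unbordered_gf q (gf_point q m) /
    (\<Prod>k<m. 1 - real q * gf_point q k)) \<longlonglongrightarrow> 0"
proof (rule Lim_null_comparison)
  show "(\<lambda>m. (1 / 2) ^ m :: real) \<longlonglongrightarrow> 0"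
    by (rule LIMSEQ_power_zero) simp
  have "\<bar>(-1) ^ m * unbordered_gf q (gf_point q m) / (\<Prod>k<m. 1 - real q * gf_point q k)\<bar>
      \<le> (1 / 2) ^ m" for m
  proof -
    have "(\<Prod>k<m. 1 / 2) \<le> (\<Prod>k<m. 1 - real q * gf_point q k)"
    proof (rule prod_mono)
      fix k
      show "0 \<le> (1 / 2 :: real) \<and> 1 / 2 \<le> 1 - real q * gf_point q k"
        using mult_gf_point_le_half[OF assms, of k] by simp
    qed
    then have P: "(1 / 2) ^ m \<le> (\<Prod>k<m. 1 - real q * gf_point q k)" by simp
    moreover have "0 < (1 / 2 :: real) ^ m" by simp
    ultimately have P0: "0 < (\<Prod>k<m. 1 - real q * gf_point q k)" by linarith
    have "unbordered_gf q (gf_point q m) / (\<Prod>k<m. 1 - real q * gf_point q k)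
        \<le> (1 / 2 ^ (2 * m)) / (1 / 2) ^ m"
      using P unbordered_gf_point_le[OF assms, of m] unbordered_gf_point_nonneg[OF assms, of m]
      by (intro frac_le) auto
    also have "\<dots> = (1 / 2) ^ m"
      by (simp add: mult_2 power_add power_one_over)
    finally show ?thesis
      using P0 unbordered_gf_point_nonneg[OF assms, of m] by (simp add: abs_mult power_abs)
  qed
  then show "\<forall>\<^sub>F m in sequentially. norm ((-1) ^ m * unbordered_gf q (gf_point q m) /
      (\<Prod>k<m. 1 - real q * gf_point q k)) \<le> (1 / 2) ^ m"
    by simp
qed

lemma unbordered_gf_sums:
  assumes "2 \<le> q"
  shows "(\<lambda>j. (-1) ^ j * (real q * gf_point q j) / (\<Prod>k=0..j. 1 - real q * gf_point q k))
    sums unbordered_gf q (gf_point q 0)"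
proof -
  let ?S = "\<lambda>m. \<Sum>j<m. (-1) ^ j * (real q * gf_point q j) /
    (\<Prod>k=0..j. 1 - real q * gf_point q k)"
  let ?R = "\<lambda>m. (-1) ^ m * unbordered_gf q (gf_point q m) /
    (\<Prod>k<m. 1 - real q * gf_point q k)"
  have "?S = (\<lambda>m. unbordered_gf q (gf_point q 0) - ?R m)"
  proof
    fix m
    show "?S m = unbordered_gf q (gf_point q 0) - ?R m"
      using unbordered_gf_iterate[OF assms, of m] by linarith
  qed
  moreover have "(\<lambda>m. unbordered_gf q (gf_point q 0) - ?R m)
      \<longlonglongrightarrow> unbordered_gf q (gf_point q 0) - 0"
    by (intro tendsto_diff tendsto_const unbordered_gf_remainder_tendsto_0 assms)
  ultimately show ?thesis
    by (simp add: sums_def)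
qed

section \<open>The limit in closed form\<close>

lemma powi_eq_mult_gf_point:
  assumes "0 < q"
  shows "real q powi (1 - 2 ^ (j + 1)) = real q * gf_point q j"
proof -
  \<comment> \<open>The exponent is a negative integer; writing the power of two as the image of a
    natural number turns the second \<open>powi\<close> into an ordinary power.\<close>
  have "real q powi (1 - 2 ^ (j + 1)) = real q powi (1 - int (2 ^ (j + 1)))"
    by simp
  also have "\<dots> = real q powi 1 / real q powi int (2 ^ (j + 1))"
    using assms by (intro power_int_diff) simp
  also have "\<dots> = real q * gf_point q j"
    unfolding power_int_of_nat gf_point_def by simp
  finally show ?thesis .
qed

text \<open>Convergence is asserted separately because \<open>lim\<close> is meaningful only for
  convergent sequences.\<close>

theorem theorem3p4:
  fixes q :: nat
  assumes "q \<ge> 2"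
  shows "convergent (\<lambda>n. prob_Z2 n q) \<and>
    (\<lambda>j::nat. (-1) ^ j * real q powi (1 - 2 ^ (j + 1)) /
        (\<Prod>k=0..j. 1 - real q powi (1 - 2 ^ (k + 1)))) sums lim_prob_Z2 q"
proof
  have lim: "(\<lambda>n. prob_Z2 n q) \<longlonglongrightarrow> unbordered_gf q (gf_point q 0)"
    using prob_Z2_tendsto[OF assms] by (simp add: gf_point_def)
  then show "convergent (\<lambda>n. prob_Z2 n q)"
    by (rule convergentI)
  have "lim_prob_Z2 q = unbordered_gf q (gf_point q 0)"
    unfolding lim_prob_Z2_def using lim by (rule limI)
  moreover have "real q powi (1 - 2 ^ (j + 1)) = real q * gf_point q j" for j
    using assms by (intro powi_eq_mult_gf_point) simp
  ultimately show "(\<lambda>j::nat. (-1) ^ j * real q powi (1 - 2 ^ (j + 1)) /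
      (\<Prod>k=0..j. 1 - real q powi (1 - 2 ^ (k + 1)))) sums lim_prob_Z2 q"
    using unbordered_gf_sums[OF assms] by presburger
qed

end
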